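(* Let $\Gamma$ be a countable discrete group acting by trace-preserving automorphisms on a finite von Neumann algebra $(M,\tau)$ with separable predual, and let $\mathcal U\subseteq\mathrm{Sub}(M)$ be a discrete URA. The following are equivalent. (1) There is a compact minimal $\Gamma$-space $\mathcal Z$, a $\Gamma$-equivariant map $\Phi:\mathcal Z\to\mathrm{Sub}(M)$ and a point of continuity $z_0\in\mathcal Z$ of $\Phi$ such that $\mathcal U=\overline{\Gamma\cdot\Phi(z_0)}$. (2) $\mathcal U$ is finite. (3) $\mathcal U$ is compact. (4) $[\Gamma:\mathcal U]<\infty$.
   Context: $\tau$ is a faithful normal tracial state. $\mathrm{Sub}(M)$ is the set of unital von Neumann subalgebras of $M$ with the Effros–Maréchal topology: the smallest topology for which all maps $N\mapsto E_N(x)\in \mathrm{L}^2(M,\tau)$, $x\in M$, are norm continuous, $E_N$ being the $\tau$-preserving conditional expectation onto $N$; closures are in this topology. Writing $\alpha$ for the action, $\Gamma$ acts on $\mathrm{Sub}(M)$ by $g\cdot N=\alpha_g(N)$. A URA is a minimal (non-empty) closed $\Gamma$-invariant subset of $\mathrm{Sub}(M)$; it is discrete if it is discrete in the subspace topology. $[\Gamma:\mathcal U]\in\mathbb N\cup\{+\infty\}$ denotes the index $[\Gamma:\mathrm{Stab}_\Gamma(N)]$ for $N\in\mathcal U$, which does not depend on $N\in\mathcal U$. A compact minimal $\Gamma$-space is a non-empty compact space with an action of $\Gamma$ by homeomorphisms all of whose orbits are dense. The map $\Phi$ in (1) is not assumed continuous. *)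

theory Defs
  imports "HOL-Analysis.Analysis" "HOL-Algebra.Group_Action" "HOL-Library.Extended_Nat"
begin

section \<open>Complex Hilbert spaces and their bounded operators\<close>

text \<open>The complex structure is added on top of the library's real inner product, which is the real
  part of the complex one; norm, topology and completeness are those of the library.  The complex
  inner product is conjugate linear in its first argument; its remaining properties (linearity in the
  second argument, definiteness) follow from the axioms below.\<close>

class complex_hilbert_space = real_inner + complete_space +
  fixes scaleC :: "complex \<Rightarrow> 'a \<Rightarrow> 'a"  (infixr \<open>*\<^sub>C\<close> 75)
    and cinner :: "'a \<Rightarrow> 'a \<Rightarrow> complex"
  assumes scaleC_add_right: "c *\<^sub>C (x + y) = c *\<^sub>C x + c *\<^sub>C y"
    and scaleC_add_left: "(c + d) *\<^sub>C x = c *\<^sub>C x + d *\<^sub>C x"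
    and scaleC_scaleC: "c *\<^sub>C (d *\<^sub>C x) = (c * d) *\<^sub>C x"
    and scaleC_of_real: "complex_of_real r *\<^sub>C x = r *\<^sub>R x"
    and cinner_commute: "cinner x y = cnj (cinner y x)"
    and cinner_add_left: "cinner (x + y) z = cinner x z + cinner y z"
    and cinner_scaleC_left: "cinner (c *\<^sub>C x) y = cnj c * cinner x y"
    and Re_cinner: "Re (cinner x y) = x \<bullet> y"

lemma norm_scaleC: "norm (c *\<^sub>C x) = cmod c * norm (x :: 'h::complex_hilbert_space)"
proof -
  have "cinner x (c *\<^sub>C x) = c * cinner x x"
    by (metis cinner_commute cinner_scaleC_left complex_cnj_cnj complex_cnj_mult)
  then have "cinner (c *\<^sub>C x) (c *\<^sub>C x) = complex_of_real ((cmod c)\<^sup>2) * cinner x x"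
    by (simp only: cinner_scaleC_left complex_norm_square mult_ac)
  then have "(norm (c *\<^sub>C x))\<^sup>2 = (cmod c)\<^sup>2 * (norm x)\<^sup>2"
    by (simp add: Re_cinner[symmetric] power2_norm_eq_inner)
  then show ?thesis
    by (metis abs_norm_cancel norm_ge_zero power2_eq_iff_nonneg power_mult_distrib
        zero_le_mult_iff)
qed

lemma bounded_linear_scaleC: "bounded_linear (\<lambda>x :: 'h::complex_hilbert_space. c *\<^sub>C x)"
proof (rule bounded_linear_intro[where K = "cmod c"])
  show "c *\<^sub>C (r *\<^sub>R x) = r *\<^sub>R (c *\<^sub>C x)" for r and x :: 'h
    by (metis mult.commute scaleC_of_real scaleC_scaleC)
qed (simp_all add: scaleC_add_right norm_scaleC mult.commute)

text \<open>The library type of bounded operators consists of the real linear ones; the elements of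
  \<open>B(H)\<close> are those which are complex linear.  The norm of the type is the usual operator norm.\<close>

type_synonym 'h op = "'h \<Rightarrow>\<^sub>L 'h"

definition bounded_ops :: "'h::complex_hilbert_space op set" where
  "bounded_ops = {T. \<forall>c x. blinfun_apply T (c *\<^sub>C x) = c *\<^sub>C blinfun_apply T x}"

definition op_scaleC :: "complex \<Rightarrow> 'h::complex_hilbert_space op \<Rightarrow> 'h op" where
  "op_scaleC c T = Blinfun (\<lambda>x. c *\<^sub>C blinfun_apply T x)"

lemma op_scaleC_apply: "blinfun_apply (op_scaleC c T) x = c *\<^sub>C blinfun_apply T x"
  unfolding op_scaleC_def
  by (simp add: bounded_linear_Blinfun_apply
      bounded_linear_compose[OF bounded_linear_scaleC blinfun.bounded_linear_right])

definition adj :: "'h::complex_hilbert_space op \<Rightarrow> 'h op" where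
  "adj T = (THE S. S \<in> bounded_ops \<and>
     (\<forall>x y. cinner (blinfun_apply T x) y = cinner x (blinfun_apply S y)))"

section \<open>Von Neumann algebras\<close>

definition commutant :: "'h::complex_hilbert_space op set \<Rightarrow> 'h op set" where
  "commutant A = {T \<in> bounded_ops. \<forall>S\<in>A. T o\<^sub>L S = S o\<^sub>L T}"

definition von_neumann_algebra :: "'h::complex_hilbert_space op set \<Rightarrow> bool" where
  "von_neumann_algebra M \<longleftrightarrow>
     M \<subseteq> bounded_ops \<and> (\<forall>T\<in>M. adj T \<in> M) \<and> commutant (commutant M) = M"

text \<open>A bicommutant contains the identity operator of the Hilbert space, so the subalgebras below
  share the unit of \<open>M\<close>.\<close>

definition vn_subalgebras :: "'h::complex_hilbert_space op set \<Rightarrow> 'h op set set" where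
  "vn_subalgebras M = {N. von_neumann_algebra N \<and> N \<subseteq> M}"

definition positive_part :: "'h::complex_hilbert_space op set \<Rightarrow> 'h op set" where
  "positive_part M = {adj T o\<^sub>L T | T. T \<in> M}"

definition linear_functional_on ::
    "'h::complex_hilbert_space op set \<Rightarrow> ('h op \<Rightarrow> complex) \<Rightarrow> bool" where
  "linear_functional_on M \<phi> \<longleftrightarrow>
     (\<forall>S\<in>M. \<forall>T\<in>M. \<phi> (S + T) = \<phi> S + \<phi> T) \<and> (\<forall>c. \<forall>T\<in>M. \<phi> (op_scaleC c T) = c * \<phi> T)"

definition linear_map_on ::
    "'h::complex_hilbert_space op set \<Rightarrow> ('h op \<Rightarrow> 'h op) \<Rightarrow> bool" where
  "linear_map_on M f \<longleftrightarrow>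
     (\<forall>S\<in>M. \<forall>T\<in>M. f (S + T) = f S + f T) \<and> (\<forall>c. \<forall>T\<in>M. f (op_scaleC c T) = op_scaleC c (f T))"

text \<open>The ultraweak (\<open>\<sigma>\<close>-weak) topology: the coarsest one for which \<open>T \<mapsto> \<Sum>n. \<langle>\<xi> n, T (\<eta> n)\<rangle>\<close> is
  continuous for all square summable sequences \<open>\<xi>\<close>, \<open>\<eta>\<close>.\<close>

definition ultraweak_topology :: "'h::complex_hilbert_space op topology" where
  "ultraweak_topology = topology_generated_by
     {(\<lambda>T. \<Sum>n. cinner (\<xi> n) (blinfun_apply T (\<eta> n))) -` V | \<xi> \<eta> V.
        summable (\<lambda>n::nat. (norm (\<xi> n))\<^sup>2) \<and> summable (\<lambda>n::nat. (norm (\<eta> n))\<^sup>2) \<and> open V}"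

definition normal_functional ::
    "'h::complex_hilbert_space op set \<Rightarrow> ('h op \<Rightarrow> complex) \<Rightarrow> bool" where
  "normal_functional M \<phi> \<longleftrightarrow> linear_functional_on M \<phi> \<and>
     continuous_map (subtopology ultraweak_topology M) euclidean \<phi>"

text \<open>The predual is the space of normal functionals on \<open>M\<close>, normed as functionals; the inequality
  says that \<open>\<phi> - \<psi>\<close> has functional norm at most \<open>\<epsilon>\<close>.\<close>

definition separable_predual :: "'h::complex_hilbert_space op set \<Rightarrow> bool" where
  "separable_predual M \<longleftrightarrow> (\<exists>D. countable D \<and> (\<forall>\<psi>\<in>D. normal_functional M \<psi>) \<and>
     (\<forall>\<phi> \<epsilon>. normal_functional M \<phi> \<and> 0 < \<epsilon> \<longrightarrow>
        (\<exists>\<psi>\<in>D. \<forall>T\<in>M. cmod (\<phi> T - \<psi> T) \<le> \<epsilon> * norm T)))"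

definition faithful_normal_tracial_state ::
    "'h::complex_hilbert_space op set \<Rightarrow> ('h op \<Rightarrow> complex) \<Rightarrow> bool" where
  "faithful_normal_tracial_state M \<tau> \<longleftrightarrow> normal_functional M \<tau> \<and>
     (\<forall>T \<in> positive_part M. \<tau> T \<in> \<real>\<^sub>\<ge>\<^sub>0) \<and> \<tau> id_blinfun = 1 \<and>
     (\<forall>S\<in>M. \<forall>T\<in>M. \<tau> (S o\<^sub>L T) = \<tau> (T o\<^sub>L S)) \<and>
     (\<forall>T\<in>M. \<tau> (adj T o\<^sub>L T) = 0 \<longrightarrow> T = 0)"

definition trace_preserving_automorphism ::
    "'h::complex_hilbert_space op set \<Rightarrow> ('h op \<Rightarrow> complex) \<Rightarrow> ('h op \<Rightarrow> 'h op) \<Rightarrow> bool" where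
  "trace_preserving_automorphism M \<tau> f \<longleftrightarrow> bij_betw f M M \<and> linear_map_on M f \<and>
     (\<forall>S\<in>M. \<forall>T\<in>M. f (S o\<^sub>L T) = f S o\<^sub>L f T) \<and> (\<forall>T\<in>M. f (adj T) = adj (f T)) \<and>
     (\<forall>T\<in>M. \<tau> (f T) = \<tau> T)"

section \<open>Conditional expectations and the Effros--Marechal topology\<close>

definition is_cond_exp :: "'h::complex_hilbert_space op set \<Rightarrow> ('h op \<Rightarrow> complex) \<Rightarrow> 'h op set \<Rightarrow>
    ('h op \<Rightarrow> 'h op) \<Rightarrow> bool" where
  "is_cond_exp M \<tau> N E \<longleftrightarrow> E \<in> M \<rightarrow>\<^sub>E N \<and> linear_map_on M E \<and> E ` positive_part M \<subseteq> positive_part N \<and>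
     (\<forall>S\<in>N. E S = S) \<and> (\<forall>S\<in>N. \<forall>T\<in>M. \<forall>R\<in>N. E (S o\<^sub>L T o\<^sub>L R) = S o\<^sub>L E T o\<^sub>L R) \<and>
     (\<forall>T\<in>M. \<tau> (E T) = \<tau> T)"

text \<open>For a von Neumann subalgebra \<open>N\<close> of \<open>M\<close> and a faithful normal tracial state \<open>\<tau>\<close> there is exactly
  one such \<open>E\<close> (Umegaki), so the default value below is never taken.\<close>

definition cond_exp :: "'h::complex_hilbert_space op set \<Rightarrow> ('h op \<Rightarrow> complex) \<Rightarrow> 'h op set \<Rightarrow>
    'h op \<Rightarrow> 'h op" where
  "cond_exp M \<tau> N = (if \<exists>E. is_cond_exp M \<tau> N E then THE E. is_cond_exp M \<tau> N E else (\<lambda>_. 0))"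

definition L2_norm :: "('h::complex_hilbert_space op \<Rightarrow> complex) \<Rightarrow> 'h op \<Rightarrow> real" where
  "L2_norm \<tau> T = sqrt (Re (\<tau> (adj T o\<^sub>L T)))"

text \<open>The norm topology that \<open>M\<close> inherits from \<open>L\<^sup>2(M, \<tau>)\<close>, its completion in the norm above.  As
  conditional expectations take values in \<open>M\<close>, continuity into \<open>L\<^sup>2(M, \<tau>)\<close> is continuity into this
  subspace.\<close>

definition L2_topology :: "'h::complex_hilbert_space op set \<Rightarrow> ('h op \<Rightarrow> complex) \<Rightarrow> 'h op topology" where
  "L2_topology M \<tau> = topology_generated_by {{T \<in> M. L2_norm \<tau> (T - S) < r} | S r. S \<in> M}"

definition effros_marechal ::
    "'h::complex_hilbert_space op set \<Rightarrow> ('h op \<Rightarrow> complex) \<Rightarrow> 'h op set topology" where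
  "effros_marechal M \<tau> = topology_generated_by
     {{N \<in> vn_subalgebras M. cond_exp M \<tau> N T \<in> V} | T V. T \<in> M \<and> openin (L2_topology M \<tau>) V}"

section \<open>Uniformly recurrent subalgebras\<close>

definition sub_action :: "('g \<Rightarrow> 'h op \<Rightarrow> 'h op) \<Rightarrow> 'g \<Rightarrow> 'h::complex_hilbert_space op set \<Rightarrow> 'h op set" where
  "sub_action \<alpha> g N = \<alpha> g ` N"

definition closed_invariant :: "('g, 'm) monoid_scheme \<Rightarrow> 'h::complex_hilbert_space op set \<Rightarrow>
    ('h op \<Rightarrow> complex) \<Rightarrow> ('g \<Rightarrow> 'h op \<Rightarrow> 'h op) \<Rightarrow> 'h op set set \<Rightarrow> bool" where
  "closed_invariant G M \<tau> \<alpha> U \<longleftrightarrow> closedin (effros_marechal M \<tau>) U \<and>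
     (\<forall>g\<in>carrier G. \<forall>N\<in>U. sub_action \<alpha> g N \<in> U)"

definition URA :: "('g, 'm) monoid_scheme \<Rightarrow> 'h::complex_hilbert_space op set \<Rightarrow>
    ('h op \<Rightarrow> complex) \<Rightarrow> ('g \<Rightarrow> 'h op \<Rightarrow> 'h op) \<Rightarrow> 'h op set set \<Rightarrow> bool" where
  "URA G M \<tau> \<alpha> U \<longleftrightarrow> U \<noteq> {} \<and> closed_invariant G M \<tau> \<alpha> U \<and>
     (\<forall>V. V \<subseteq> U \<and> V \<noteq> {} \<and> closed_invariant G M \<tau> \<alpha> V \<longrightarrow> V = U)"

definition discrete_URA :: "('g, 'm) monoid_scheme \<Rightarrow> 'h::complex_hilbert_space op set \<Rightarrow>
    ('h op \<Rightarrow> complex) \<Rightarrow> ('g \<Rightarrow> 'h op \<Rightarrow> 'h op) \<Rightarrow> 'h op set set \<Rightarrow> bool" where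
  "discrete_URA G M \<tau> \<alpha> U \<longleftrightarrow> URA G M \<tau> \<alpha> U \<and>
     subtopology (effros_marechal M \<tau>) U = discrete_topology U"

definition group_index :: "('g, 'm) monoid_scheme \<Rightarrow> 'g set \<Rightarrow> enat" where
  "group_index G H = (if finite (rcosets\<^bsub>G\<^esub> H) then enat (card (rcosets\<^bsub>G\<^esub> H)) else \<infinity>)"

definition URA_index :: "('g, 'm) monoid_scheme \<Rightarrow> ('g \<Rightarrow> 'h op \<Rightarrow> 'h op) \<Rightarrow>
    'h::complex_hilbert_space op set set \<Rightarrow> enat" where
  "URA_index G \<alpha> U = (THE k. \<forall>N\<in>U. k = group_index G (stabilizer G (sub_action \<alpha>) N))"

definition compact_minimal_space ::
    "('g, 'm) monoid_scheme \<Rightarrow> 'z topology \<Rightarrow> ('g \<Rightarrow> 'z \<Rightarrow> 'z) \<Rightarrow> bool" where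
  "compact_minimal_space G Z \<rho> \<longleftrightarrow> topspace Z \<noteq> {} \<and> compact_space Z \<and>
     group_action G (topspace Z) \<rho> \<and> (\<forall>g\<in>carrier G. homeomorphic_map Z Z (\<rho> g)) \<and>
     (\<forall>z\<in>topspace Z. Z closure_of (orbit G \<rho> z) = topspace Z)"

definition equivariant_to_sub :: "('g, 'm) monoid_scheme \<Rightarrow> 'h::complex_hilbert_space op set \<Rightarrow>
    ('g \<Rightarrow> 'h op \<Rightarrow> 'h op) \<Rightarrow> 'z topology \<Rightarrow> ('g \<Rightarrow> 'z \<Rightarrow> 'z) \<Rightarrow> ('z \<Rightarrow> 'h op set) \<Rightarrow> bool" where
  "equivariant_to_sub G M \<alpha> Z \<rho> \<Phi> \<longleftrightarrow> \<Phi> \<in> topspace Z \<rightarrow> vn_subalgebras M \<and>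
     (\<forall>g\<in>carrier G. \<forall>z\<in>topspace Z. \<Phi> (\<rho> g z) = sub_action \<alpha> g (\<Phi> z))"

text \<open>Membership of \<open>z\<^sub>0\<close> in the space is part of \<open>topcontinuous_at\<close>.  Existence of a space of
  arbitrary size is existence of a \<open>Z\<close> over some type; since types cannot be quantified inside a
  formula, one uses a fixed type together with a reduction from an arbitrary \<open>'z\<close> to it.\<close>

definition arises_from :: "('g, 'm) monoid_scheme \<Rightarrow> 'h::complex_hilbert_space op set \<Rightarrow>
    ('h op \<Rightarrow> complex) \<Rightarrow> ('g \<Rightarrow> 'h op \<Rightarrow> 'h op) \<Rightarrow> 'h op set set \<Rightarrow> 'z topology \<Rightarrow> bool" where
  "arises_from G M \<tau> \<alpha> U Z \<longleftrightarrow> (\<exists>\<rho> \<Phi> z\<^sub>0. compact_minimal_space G Z \<rho> \<and>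
     equivariant_to_sub G M \<alpha> Z \<rho> \<Phi> \<and> topcontinuous_at Z (effros_marechal M \<tau>) \<Phi> z\<^sub>0 \<and>
     U = effros_marechal M \<tau> closure_of (orbit G (sub_action \<alpha>) (\<Phi> z\<^sub>0)))"

end

theory Submission
  imports Defs
begin

text \<open>
  A discrete closed set has only closed subsets, so every non-empty invariant subset of a discrete URA
  \<open>U\<close> is closed and hence, by minimality, is all of \<open>U\<close>: a discrete URA is a single orbit
  (\<open>discrete_URA_eq_orbit\<close>).  The orbit-stabilizer bijection then identifies \<open>[\<Gamma> : U]\<close> with the
  number of elements of \<open>U\<close> (\<open>discrete_URA_index\<close>), and a discrete set is compact exactly when it is
  finite.  A finite \<open>U\<close> is itself a compact minimal space, and the identity map of \<open>U\<close> shows that it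
  arises from this space.

  The remaining implication (\<open>finite_orbit_if_isolated_at_continuity_point\<close>) concerns actions on
  topological spaces.  As \<open>\<Phi> z\<^sub>0\<close> is isolated in its orbit, continuity at \<open>z\<^sub>0\<close> gives a neighbourhood
  \<open>V\<close> of \<open>z\<^sub>0\<close> such that \<open>\<Phi>\<close> takes the value \<open>\<Phi> z\<^sub>0\<close> at each point of \<open>\<Gamma> z\<^sub>0\<close> in \<open>V\<close>.  By minimality
  and compactness finitely many translates of \<open>V\<close> cover the space, whence \<open>\<Phi>\<close> has only finitely many
  values on \<open>\<Gamma> z\<^sub>0\<close>.  These values are the orbit of \<open>\<Phi> z\<^sub>0\<close>, which is \<open>U\<close>.
\<close>

text \<open>Permutations in the sense of \<open>BijGroup\<close> are extensional, which is why an action given by its two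
  laws has to be restricted to the set on which it acts.\<close>

lemma group_action_restrictI:
  assumes "group G"
    and closed: "\<And>g x. g \<in> carrier G \<Longrightarrow> x \<in> E \<Longrightarrow> \<phi> g x \<in> E"
    and one: "\<And>x. x \<in> E \<Longrightarrow> \<phi> \<one>\<^bsub>G\<^esub> x = x"
    and mult: "\<And>g h x. g \<in> carrier G \<Longrightarrow> h \<in> carrier G \<Longrightarrow> x \<in> E \<Longrightarrow>
                 \<phi> (g \<otimes>\<^bsub>G\<^esub> h) x = \<phi> g (\<phi> h x)"
  shows "group_action G E (\<lambda>g. restrict (\<phi> g) E)"
proof -
  interpret group G by fact
  have bij: "restrict (\<phi> g) E \<in> Bij E" if g: "g \<in> carrier G" for g
  proof -
    have "bij_betw (\<phi> g) E E"
    proof (rule bij_betw_byWitness[where f' = "\<phi> (inv\<^bsub>G\<^esub> g)"])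
      show "\<forall>x\<in>E. \<phi> (inv\<^bsub>G\<^esub> g) (\<phi> g x) = x"
        using g one by (simp flip: mult)
      show "\<forall>x\<in>E. \<phi> g (\<phi> (inv\<^bsub>G\<^esub> g) x) = x"
        using g one by (simp flip: mult)
    qed (use g closed in auto)
    then show ?thesis
      by (simp add: Bij_def bij_betw_restrict_eq)
  qed
  have "restrict (\<phi> (g \<otimes>\<^bsub>G\<^esub> h)) E = compose E (restrict (\<phi> g) E) (restrict (\<phi> h) E)"
    if "g \<in> carrier G" "h \<in> carrier G" for g h
    using that closed mult by (auto simp: compose_def restrict_def)
  then have "(\<lambda>g. restrict (\<phi> g) E) \<in> hom G (BijGroup E)"
    using bij by (auto simp: hom_def BijGroup_def)
  then show ?thesis
    by (simp add: group_action_def group_hom_def group_hom_axioms_def group_BijGroup is_group)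
qed

lemma orbit_restrict:
  "x \<in> E \<Longrightarrow> orbit G (\<lambda>g. restrict (\<phi> g) E) x = orbit G \<phi> x"
  by (auto simp: orbit_def)

lemma stabilizer_restrict:
  "x \<in> E \<Longrightarrow> stabilizer G (\<lambda>g. restrict (\<phi> g) E) x = stabilizer G \<phi> x"
  by (auto simp: stabilizer_def)

text \<open>Continuity at \<open>z\<^sub>0\<close> makes \<open>\<Phi>\<close> constant on the part of \<open>\<Gamma> z\<^sub>0\<close> in some open \<open>V\<close>.  Density of all
  orbits makes the translates of \<open>V\<close> a cover, and equivariance carries the constancy to each of the
  finitely many translates that suffice.  Only points of \<open>\<Gamma> z\<^sub>0\<close> are controlled: elsewhere in \<open>V\<close> the
  values of \<open>\<Phi>\<close> need not lie in the orbit.\<close>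

lemma finite_orbit_if_isolated_at_continuity_point:
  assumes Z: "compact_minimal_space G Z \<rho>"
    and equiv: "\<And>g z. g \<in> carrier G \<Longrightarrow> z \<in> topspace Z \<Longrightarrow> \<Phi> (\<rho> g z) = \<phi> g (\<Phi> z)"
    and cont: "topcontinuous_at Z Y \<Phi> z\<^sub>0"
    and W: "openin Y W" and isolated: "W \<inter> orbit G \<phi> (\<Phi> z\<^sub>0) = {\<Phi> z\<^sub>0}"
  shows "finite (orbit G \<phi> (\<Phi> z\<^sub>0))"
proof -
  interpret group_action G "topspace Z" \<rho>
    using Z by (simp add: compact_minimal_space_def)
  interpret group G
    using group_hom group_hom.axioms(1) by auto
  have z\<^sub>0: "z\<^sub>0 \<in> topspace Z"
    using cont by (simp add: topcontinuous_at_def)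
  obtain V where V: "openin Z V" "z\<^sub>0 \<in> V" "\<And>z. z \<in> V \<Longrightarrow> \<Phi> z \<in> W"
    using cont W isolated unfolding topcontinuous_at_def by (metis Int_iff singletonI)
  define T where "T = (\<lambda>g. {z \<in> topspace Z. \<rho> g z \<in> V})"
  have T_open: "openin Z (T g)" if "g \<in> carrier G" for g
  proof -
    have "continuous_map Z Z (\<rho> g)"
      using Z that by (simp add: compact_minimal_space_def homeomorphic_imp_continuous_map)
    then show ?thesis
      using V(1) by (simp add: T_def openin_continuous_map_preimage)
  qed
  have "topspace Z \<subseteq> \<Union> (T ` carrier G)"
  proof
    fix z assume z: "z \<in> topspace Z"
    then have "z\<^sub>0 \<in> Z closure_of (orbit G \<rho> z)"
      using Z z\<^sub>0 by (simp add: compact_minimal_space_def)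
    then obtain y where "y \<in> orbit G \<rho> z" "y \<in> V"
      using V(1,2) by (auto simp: in_closure_of)
    then show "z \<in> \<Union> (T ` carrier G)"
      using z by (auto simp: T_def orbit_def)
  qed
  moreover have "compactin Z (topspace Z)"
    using Z by (simp add: compact_minimal_space_def compact_space_def)
  ultimately obtain \<F> where "finite \<F>" "\<F> \<subseteq> T ` carrier G" "topspace Z \<subseteq> \<Union> \<F>"
    using T_open unfolding compactin_def by (metis (no_types, lifting) imageE)
  then obtain F where F: "finite F" "F \<subseteq> carrier G" "topspace Z \<subseteq> \<Union> (T ` F)"
    by (metis finite_subset_image)
  \<comment> \<open>If \<open>f\<close> moves \<open>g z\<^sub>0\<close> into \<open>V\<close>, then \<open>\<Phi> (f g z\<^sub>0) = \<Phi> z\<^sub>0\<close>, so \<open>\<Phi> (g z\<^sub>0)\<close> is determined by \<open>f\<close>.\<close>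
  have "orbit G \<phi> (\<Phi> z\<^sub>0) \<subseteq> (\<lambda>f. \<phi> (inv\<^bsub>G\<^esub> f) (\<Phi> z\<^sub>0)) ` F"
  proof
    fix y assume "y \<in> orbit G \<phi> (\<Phi> z\<^sub>0)"
    then obtain g where g: "g \<in> carrier G" "y = \<phi> g (\<Phi> z\<^sub>0)"
      by (auto simp: orbit_def)
    have gz: "\<rho> g z\<^sub>0 \<in> topspace Z"
      using element_image g(1) z\<^sub>0 by blast
    then obtain f where f: "f \<in> F" "\<rho> f (\<rho> g z\<^sub>0) \<in> V"
      using F(3) by (auto simp: T_def)
    then have fG: "f \<in> carrier G"
      using F(2) by blast
    have fg: "\<rho> f (\<rho> g z\<^sub>0) = \<rho> (f \<otimes>\<^bsub>G\<^esub> g) z\<^sub>0"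
      using composition_rule fG g(1) z\<^sub>0 by simp
    have "\<Phi> (\<rho> f (\<rho> g z\<^sub>0)) \<in> W \<inter> orbit G \<phi> (\<Phi> z\<^sub>0)"
      using V(3)[OF f(2)] fG g(1) z\<^sub>0 by (auto simp: fg equiv orbit_def)
    then have const: "\<Phi> (\<rho> f (\<rho> g z\<^sub>0)) = \<Phi> z\<^sub>0"
      using isolated by simp
    have "y = \<Phi> (\<rho> g z\<^sub>0)"
      using g z\<^sub>0 by (simp add: equiv)
    also have "\<dots> = \<Phi> (\<rho> (inv\<^bsub>G\<^esub> f) (\<rho> f (\<rho> g z\<^sub>0)))"
      using orbit_sym_aux[OF fG gz refl] by simp
    also have "\<dots> = \<phi> (inv\<^bsub>G\<^esub> f) (\<Phi> z\<^sub>0)"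
      using fG gz element_image by (simp add: equiv const)
    finally show "y \<in> (\<lambda>f. \<phi> (inv\<^bsub>G\<^esub> f) (\<Phi> z\<^sub>0)) ` F"
      using f(1) by blast
  qed
  then show ?thesis
    using F(1) finite_surj by blast
qed

lemma topspace_effros_marechal_subset: "topspace (effros_marechal M \<tau>) \<subseteq> vn_subalgebras M"
  by (auto simp: effros_marechal_def)

lemma group_action_sub_action:
  assumes \<alpha>: "group_action G M \<alpha>" and U: "U \<subseteq> Pow M"
    and inv: "\<And>g N. g \<in> carrier G \<Longrightarrow> N \<in> U \<Longrightarrow> sub_action \<alpha> g N \<in> U"
  shows "group_action G U (\<lambda>g. restrict (sub_action \<alpha> g) U)"
proof (rule group_action_restrictI)
  interpret group_action G M \<alpha> by fact
  show "group G"
    using group_hom group_hom.axioms(1) by auto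
  show "sub_action \<alpha> \<one>\<^bsub>G\<^esub> N = N" if "N \<in> U" for N
    using that U by (force simp: sub_action_def simp flip: id_eq_one)
  show "sub_action \<alpha> (g \<otimes>\<^bsub>G\<^esub> h) N = sub_action \<alpha> g (sub_action \<alpha> h N)"
    if "g \<in> carrier G" "h \<in> carrier G" "N \<in> U" for g h N
  proof -
    have "N \<subseteq> M" using that(3) U by blast
    then show ?thesis
      unfolding sub_action_def image_image
      by (intro image_cong) (use that composition_rule in auto)
  qed
qed (rule inv)

lemma URA_group_action:
  assumes "group_action G M \<alpha>" and "URA G M \<tau> \<alpha> U"
  shows "group_action G U (\<lambda>g. restrict (sub_action \<alpha> g) U)"
proof (rule group_action_sub_action)
  have "U \<subseteq> vn_subalgebras M"
    using assms(2) closedin_subset topspace_effros_marechal_subset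
    unfolding URA_def closed_invariant_def by fast
  then show "U \<subseteq> Pow M"
    by (auto simp: vn_subalgebras_def)
qed (use assms in \<open>auto simp: URA_def closed_invariant_def\<close>)

text \<open>Discreteness is what makes an orbit closed; minimality then leaves no room for a second one.\<close>

lemma discrete_URA_eq_orbit:
  assumes \<alpha>: "group_action G M \<alpha>" and U: "discrete_URA G M \<tau> \<alpha> U" and N: "N \<in> U"
  shows "orbit G (sub_action \<alpha>) N = U"
proof -
  have URA: "URA G M \<tau> \<alpha> U"
    and discrete: "subtopology (effros_marechal M \<tau>) U = discrete_topology U"
    using U by (auto simp: discrete_URA_def)
  interpret group_action G U "\<lambda>g. restrict (sub_action \<alpha> g) U"
    using \<alpha> URA by (rule URA_group_action)
  let ?O = "orbit G (sub_action \<alpha>) N"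
  have inv: "sub_action \<alpha> g K \<in> U" if "g \<in> carrier G" "K \<in> U" for g K
    using URA that by (auto simp: URA_def closed_invariant_def)
  have sub: "?O \<subseteq> U"
    using inv N by (auto simp: orbit_def)
  have "closedin (effros_marechal M \<tau>) ?O"
    by (rule closedin_trans_full[of _ U])
      (use sub URA in \<open>auto simp: discrete URA_def closed_invariant_def\<close>)
  moreover have "sub_action \<alpha> g K \<in> ?O" if "g \<in> carrier G" "K \<in> ?O" for g K
  proof -
    have K: "K \<in> U" using that(2) sub by blast
    have "sub_action \<alpha> g K \<in> orbit G (sub_action \<alpha>) K"
      using that(1) by (auto simp: orbit_def)
    then show ?thesis
      using orbit_trans[of N K "sub_action \<alpha> g K"] N K that inv by (simp add: orbit_restrict)
  qed
  moreover have "N \<in> ?O"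
    using orbit_refl N by (simp add: orbit_restrict)
  ultimately show ?thesis
    using URA sub unfolding URA_def closed_invariant_def by blast
qed

text \<open>Since \<open>U\<close> is the orbit of each of its points, all of them give the same index; this is what
  determines the description operator in \<open>URA_index\<close>.\<close>

lemma discrete_URA_index:
  assumes \<alpha>: "group_action G M \<alpha>" and U: "discrete_URA G M \<tau> \<alpha> U"
  shows "URA_index G \<alpha> U = (if finite U then enat (card U) else \<infinity>)"
proof -
  have URA: "URA G M \<tau> \<alpha> U"
    using U by (simp add: discrete_URA_def)
  interpret group_action G U "\<lambda>g. restrict (sub_action \<alpha> g) U"
    using \<alpha> URA by (rule URA_group_action)
  have index: "group_index G (stabilizer G (sub_action \<alpha>) N) = (if finite U then enat (card U) else \<infinity>)"
    if N: "N \<in> U" for N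
  proof -
    have "\<exists>f. bij_betw f (rcosets\<^bsub>G\<^esub> (stabilizer G (sub_action \<alpha>) N)) U"
      using orbit_stab_fun_is_bij[OF N] discrete_URA_eq_orbit[OF \<alpha> U N]
      unfolding orbit_restrict[OF N] stabilizer_restrict[OF N] by metis
    then show ?thesis
      unfolding group_index_def by (metis bij_betw_finite bij_betw_same_card)
  qed
  obtain N where "N \<in> U"
    using URA by (auto simp: URA_def)
  then show ?thesis
    unfolding URA_index_def using index by (intro the_equality) auto
qed

lemma discrete_URA_compactin_iff:
  assumes "discrete_URA G M \<tau> \<alpha> U"
  shows "compactin (effros_marechal M \<tau>) U \<longleftrightarrow> finite U"
proof -
  have "subtopology (effros_marechal M \<tau>) U = discrete_topology U"
    and "closedin (effros_marechal M \<tau>) U"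
    using assms by (auto simp: discrete_URA_def URA_def closed_invariant_def)
  then show ?thesis
    by (simp add: compactin_subspace compact_space_discrete_topology closedin_subset)
qed

lemma discrete_URA_finite_if_arises:
  assumes \<alpha>: "group_action G M \<alpha>" and U: "discrete_URA G M \<tau> \<alpha> U"
    and "arises_from G M \<tau> \<alpha> U Z"
  shows "finite U"
proof -
  let ?X = "effros_marechal M \<tau>"
  obtain \<rho> \<Phi> z\<^sub>0 where Z: "compact_minimal_space G Z \<rho>"
    and equiv: "\<And>g z. g \<in> carrier G \<Longrightarrow> z \<in> topspace Z \<Longrightarrow> \<Phi> (\<rho> g z) = sub_action \<alpha> g (\<Phi> z)"
    and cont: "topcontinuous_at Z ?X \<Phi> z\<^sub>0"
    and closure: "U = ?X closure_of (orbit G (sub_action \<alpha>) (\<Phi> z\<^sub>0))"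
    using assms(3) unfolding arises_from_def equivariant_to_sub_def by blast
  interpret group_action G "topspace Z" \<rho>
    using Z by (simp add: compact_minimal_space_def)
  have z\<^sub>0: "z\<^sub>0 \<in> topspace Z" and \<Phi>: "\<Phi> \<in> topspace Z \<rightarrow> topspace ?X"
    using cont by (auto simp: topcontinuous_at_def)
  have orbit_\<Phi>: "orbit G (sub_action \<alpha>) (\<Phi> z\<^sub>0) = \<Phi> ` orbit G \<rho> z\<^sub>0"
    using equiv[OF _ z\<^sub>0] unfolding orbit_def by (simp add: setcompr_eq_image image_image)
  have "orbit G \<rho> z\<^sub>0 \<subseteq> topspace Z"
    using element_image z\<^sub>0 by (auto simp: orbit_def)
  then have "orbit G (sub_action \<alpha>) (\<Phi> z\<^sub>0) \<subseteq> U"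
    using \<Phi> unfolding closure by (intro closure_of_subset) (auto simp: orbit_\<Phi>)
  moreover have "\<Phi> z\<^sub>0 \<in> orbit G (sub_action \<alpha>) (\<Phi> z\<^sub>0)"
    using orbit_refl[OF z\<^sub>0] by (simp add: orbit_\<Phi>)
  ultimately have in_U: "\<Phi> z\<^sub>0 \<in> U"
    by blast
  have orbit_U: "orbit G (sub_action \<alpha>) (\<Phi> z\<^sub>0) = U"
    using \<alpha> U in_U by (rule discrete_URA_eq_orbit)
  have "openin (subtopology ?X U) {\<Phi> z\<^sub>0}"
    using U in_U by (simp add: discrete_URA_def)
  then obtain W where "openin ?X W" "W \<inter> U = {\<Phi> z\<^sub>0}"
    by (auto simp: openin_subtopology)
  then show ?thesis
    using finite_orbit_if_isolated_at_continuity_point[OF Z equiv cont] orbit_U by simp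
qed

text \<open>The witness is \<open>U\<close> with its discrete topology, which is compact because \<open>U\<close> is finite and minimal
  because \<open>U\<close> is one orbit, together with the inclusion of \<open>U\<close>.\<close>

lemma discrete_URA_arises_if_finite:
  assumes \<alpha>: "group_action G M \<alpha>" and U: "discrete_URA G M \<tau> \<alpha> U" and fin: "finite U"
  shows "arises_from G M \<tau> \<alpha> U (discrete_topology U)"
proof -
  let ?X = "effros_marechal M \<tau>" and ?\<rho> = "\<lambda>g. restrict (sub_action \<alpha> g) U"
  have URA: "URA G M \<tau> \<alpha> U" and closed: "closedin ?X U"
    using U by (auto simp: discrete_URA_def URA_def closed_invariant_def)
  interpret group_action G U ?\<rho>
    using \<alpha> URA by (rule URA_group_action)
  obtain N where N: "N \<in> U"
    using URA by (auto simp: URA_def)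
  have "homeomorphic_map (discrete_topology U) (discrete_topology U) (?\<rho> g)" if "g \<in> carrier G" for g
    using surj_prop[OF that] inj_prop[OF that]
    by (intro bijective_open_imp_homeomorphic_map) (auto simp: open_map_def)
  then have "compact_minimal_space G (discrete_topology U) ?\<rho>"
    using N fin group_action_axioms discrete_URA_eq_orbit[OF \<alpha> U]
    by (auto simp: compact_minimal_space_def compact_space_discrete_topology
        orbit_restrict discrete_topology_closure_of)
  moreover have "equivariant_to_sub G M \<alpha> (discrete_topology U) ?\<rho> id"
    using closedin_subset[OF closed] topspace_effros_marechal_subset
    by (fastforce simp: equivariant_to_sub_def)
  moreover have "topcontinuous_at (discrete_topology U) ?X id N"
    using N closedin_subset[OF closed] unfolding topcontinuous_at_def
    by (auto intro: exI[of _ "{N}"])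
  moreover have "U = ?X closure_of (orbit G (sub_action \<alpha>) (id N))"
    using discrete_URA_eq_orbit[OF \<alpha> U N] closed by (simp add: closure_of_closedin)
  ultimately show ?thesis
    unfolding arises_from_def by blast
qed

theorem proposition6p16:
  fixes G :: "('g, 'm) monoid_scheme"
    and M :: "'h::complex_hilbert_space op set"
    and \<tau> :: "'h op \<Rightarrow> complex"
    and \<alpha> :: "'g \<Rightarrow> 'h op \<Rightarrow> 'h op"
    and U :: "'h op set set"
  assumes "group G" and "countable (carrier G)"
    and "von_neumann_algebra M" and "separable_predual M"
    and "faithful_normal_tracial_state M \<tau>"
    and "group_action G M \<alpha>"
    and "\<And>g. g \<in> carrier G \<Longrightarrow> trace_preserving_automorphism M \<tau> (\<alpha> g)"
    and "discrete_URA G M \<tau> \<alpha> U"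
  shows "((\<exists>Z :: 'h op set topology. arises_from G M \<tau> \<alpha> U Z) \<longleftrightarrow> finite U) \<and>
         (finite U \<longleftrightarrow> compactin (effros_marechal M \<tau>) U) \<and>
         (compactin (effros_marechal M \<tau>) U \<longleftrightarrow> URA_index G \<alpha> U < \<infinity>) \<and>
         ((\<exists>Z :: 'z topology. arises_from G M \<tau> \<alpha> U Z) \<longrightarrow>
          (\<exists>Z :: 'h op set topology. arises_from G M \<tau> \<alpha> U Z))"
proof -
  note finite_if_arises = discrete_URA_finite_if_arises[OF assms(6,8)]
  have arises: "arises_from G M \<tau> \<alpha> U (discrete_topology U)" if "finite U"
    using discrete_URA_arises_if_finite[OF assms(6,8) that] .
  have 1: "(\<exists>Z :: 'h op set topology. arises_from G M \<tau> \<alpha> U Z) \<longleftrightarrow> finite U"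
    using finite_if_arises arises by blast
  have 2: "finite U \<longleftrightarrow> compactin (effros_marechal M \<tau>) U"
    using discrete_URA_compactin_iff[OF assms(8)] by simp
  have 3: "finite U \<longleftrightarrow> URA_index G \<alpha> U < \<infinity>"
    using discrete_URA_index[OF assms(6,8)] by simp
  have 4: "(\<exists>Z :: 'z topology. arises_from G M \<tau> \<alpha> U Z) \<longrightarrow> finite U"
    using finite_if_arises by blast
  show ?thesis
    using 1 2 3 4 by simp
qed

end
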